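(* Consider the sum-throughput maximization problem under successive interference cancellation decoding, $\mathbf{P1_{SICD}}$, in the variables $\tau_0=(\tau_{0,t})_t$, $\mathbf{E}=(E_{i,t})_{i,t}$ and $\mathbf{x}=(x_{i,t})_{i,t}$, $i=1,\dots,K$, $t=1,\dots,T$: $$\max_{\tau_0,\mathbf{E},\mathbf{x}}\ \sum_{t=1}^{T}\sum_{i=1}^{K}R_{i,t},\qquad R_{i,t}=(1-\tau_{0,t})\log_2(1+x_{i,t}),$$ subject to $$x_{i,t}=\frac{g_{i,t}E_{i,t}}{\sigma^2(1-\tau_{0,t})+\sum_{j=i+1}^{K}g_{j,t}E_{j,t}}\quad\forall i,\forall t,$$ $$\sum_{n=1}^{t}E_{i,n}\le\sum_{n=1}^{t}\gamma_{i,n}\tau_{0,n}\quad\forall i,\forall t,$$ $$x_{i,t}\ge S_i^{th}\quad\forall i,\forall t,\qquad 0\le\tau_{0,t}\le 1\quad\forall t,\qquad E_{i,t}\ge 0\quad\forall i,\forall t.$$ For each $t$, the sum throughput $R_{sum}^{(t)}=\sum_{i=1}^{K}R_{i,t}$, which equals $$R_{sum}^{(t)}=(1-\tau_{0,t})\log_2\left(1+\frac{\sum_{i=1}^{K}g_{i,t}E_{i,t}}{\sigma^2(1-\tau_{0,t})}\right),$$ is a concave function of $[\tau_{0,t},E_{1,t},\dots,E_{K,t}]$. Hence the objective function of $\mathbf{P1_{SICD}}$, being the sum of the $R_{sum}^{(t)}$ over $t$, is a concave function of $(\tau_0,\mathbf{E})$. In addition, all constraints of $\mathbf{P1_{SICD}}$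 are affine in $(\tau_0,\mathbf{E})$. As a result, $\mathbf{P1_{SICD}}$ is a convex optimization problem.
   Context: A wireless powered communication network has $K$ users, an energy-rich node, an access point, and a finite horizon of $T$ time slots of unit length. In slot $t$ the energy-rich node broadcasts wireless energy for a duration $\tau_{0,t}$, and during the remaining duration $1-\tau_{0,t}$ all users transmit data simultaneously and independently to the access point. User $i$ harvests energy $\gamma_{i,t}\tau_{0,t}$ in slot $t$, where $\gamma_{i,t}=\eta_i h_{i,t}P_B$, with $\eta_i$ the harvesting efficiency, $h_{i,t}$ the downlink channel power gain and $P_B$ the average transmit power of the energy-rich node. $E_{i,t}$ is the energy used by user $i$ in slot $t$, $g_{i,t}$ is its uplink channel power gain, $\sigma^2$ is the noise power at the access point, and $S_i^{th}$ is the predefined decoding threshold of user $i$. Under successive interference cancellation decoding (SICD), every decoded user's signal is removed from the interference of the users decoded next, in the order $1,\dots,K$; thus $x_{i,t}$ is the signal-to-interference-and-noise ratio of user $i$ in slot $t$, and $R_{i,t}$ is its achievable throughput. Empty sums are zero. *)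

theory Defs
  imports "HOL-Analysis.Analysis"
begin

(* Users and slots are indexed by finite linearly ordered types 'k and 't, standing for
   {1..K} and {1..T}; the order of 'k is the decoding order and the order of 't is time.
   A point is (\<tau>, E, x) with \<tau> $ t the energy-transfer duration, E $ t $ i the energy
   and x $ t $ i the SINR of user i in slot t. *)

type_synonym ('k, 't) alloc = "(real ^ 't) \<times> (real ^ 'k ^ 't)"
type_synonym ('k, 't) point = "(real ^ 't) \<times> (real ^ 'k ^ 't) \<times> (real ^ 'k ^ 't)"

definition interference_noise ::
    "('k \<Rightarrow> 't \<Rightarrow> real) \<Rightarrow> real \<Rightarrow> 't \<Rightarrow> 'k \<Rightarrow> real \<times> (real ^ 'k::{finite,linorder}) \<Rightarrow> real" where
  "interference_noise g \<sigma> t i = (\<lambda>(s, e). \<sigma>\<^sup>2 * (1 - s) + (\<Sum>j\<in>{i<..}. g j t * e $ j))"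

definition sinr ::
    "('k \<Rightarrow> 't \<Rightarrow> real) \<Rightarrow> real \<Rightarrow> 't \<Rightarrow> 'k \<Rightarrow> real \<times> (real ^ 'k::{finite,linorder}) \<Rightarrow> real" where
  "sinr g \<sigma> t i = (\<lambda>(s, e). g i t * e $ i / interference_noise g \<sigma> t i (s, e))"

definition throughput :: "real \<Rightarrow> real \<Rightarrow> real" where
  "throughput s y = (1 - s) * log 2 (1 + y)"

definition sum_throughput ::
    "('k \<Rightarrow> 't \<Rightarrow> real) \<Rightarrow> real \<Rightarrow> 't \<Rightarrow> real \<times> (real ^ 'k::{finite,linorder}) \<Rightarrow> real" where
  "sum_throughput g \<sigma> t = (\<lambda>(s, e). \<Sum>i\<in>UNIV. throughput s (sinr g \<sigma> t i (s, e)))"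

definition slot_box :: "(real \<times> (real ^ 'k)) set" where
  "slot_box = {(s, e). 0 \<le> s \<and> s \<le> 1 \<and> (\<forall>i. 0 \<le> e $ i)}"

definition sinr_equation ::
    "('k \<Rightarrow> 't \<Rightarrow> real) \<Rightarrow> real \<Rightarrow> 'k \<Rightarrow> 't \<Rightarrow> ('k::{finite,linorder}, 't::finite) point \<Rightarrow> bool" where
  "sinr_equation g \<sigma> i t = (\<lambda>(\<tau>, E, x). x $ t $ i = sinr g \<sigma> t i (\<tau> $ t, E $ t))"

definition energy_causality ::
    "('k \<Rightarrow> 't \<Rightarrow> real) \<Rightarrow> 'k \<Rightarrow> 't \<Rightarrow> ('k::finite, 't::{finite,linorder}) point \<Rightarrow> bool" where
  "energy_causality \<gamma> i t = (\<lambda>(\<tau>, E, x). (\<Sum>n\<in>{..t}. E $ n $ i) \<le> (\<Sum>n\<in>{..t}. \<gamma> i n * \<tau> $ n))"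

definition decoding_threshold ::
    "('k \<Rightarrow> real) \<Rightarrow> 'k \<Rightarrow> 't \<Rightarrow> ('k::finite, 't::finite) point \<Rightarrow> bool" where
  "decoding_threshold S i t = (\<lambda>(\<tau>, E, x). x $ t $ i \<ge> S i)"

definition duration_lower :: "'t \<Rightarrow> ('k::finite, 't::finite) point \<Rightarrow> bool" where
  "duration_lower t = (\<lambda>(\<tau>, E, x). 0 \<le> \<tau> $ t)"

definition duration_upper :: "'t \<Rightarrow> ('k::finite, 't::finite) point \<Rightarrow> bool" where
  "duration_upper t = (\<lambda>(\<tau>, E, x). \<tau> $ t \<le> 1)"

definition energy_nonneg :: "'k \<Rightarrow> 't \<Rightarrow> ('k::finite, 't::finite) point \<Rightarrow> bool" where
  "energy_nonneg i t = (\<lambda>(\<tau>, E, x). 0 \<le> E $ t $ i)"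

definition P1_feasible ::
    "('k \<Rightarrow> 't \<Rightarrow> real) \<Rightarrow> real \<Rightarrow> ('k \<Rightarrow> 't \<Rightarrow> real) \<Rightarrow> ('k \<Rightarrow> real)
      \<Rightarrow> ('k::{finite,linorder}, 't::{finite,linorder}) point set" where
  "P1_feasible g \<sigma> \<gamma> S = {p. \<forall>i t.
      sinr_equation g \<sigma> i t p \<and> energy_causality \<gamma> i t p \<and> decoding_threshold S i t p \<and>
      duration_lower t p \<and> duration_upper t p \<and> energy_nonneg i t p}"

definition P1_objective :: "('k::finite, 't::finite) point \<Rightarrow> real" where
  "P1_objective = (\<lambda>(\<tau>, E, x). \<Sum>t\<in>UNIV. \<Sum>i\<in>UNIV. throughput (\<tau> $ t) (x $ t $ i))"

definition with_sinr ::
    "('k \<Rightarrow> 't \<Rightarrow> real) \<Rightarrow> real \<Rightarrow> ('k::{finite,linorder}, 't::finite) alloc \<Rightarrow> ('k, 't) point" where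
  "with_sinr g \<sigma> = (\<lambda>(\<tau>, E). (\<tau>, E, \<chi> t i. sinr g \<sigma> t i (\<tau> $ t, E $ t)))"

definition P1_allocations ::
    "('k \<Rightarrow> 't \<Rightarrow> real) \<Rightarrow> real \<Rightarrow> ('k \<Rightarrow> 't \<Rightarrow> real) \<Rightarrow> ('k \<Rightarrow> real)
      \<Rightarrow> ('k::{finite,linorder}, 't::{finite,linorder}) alloc set" where
  "P1_allocations g \<sigma> \<gamma> S = {(\<tau>, E). \<exists>x. (\<tau>, E, x) \<in> P1_feasible g \<sigma> \<gamma> S}"

definition alloc_box :: "('k::finite, 't::finite) alloc set" where
  "alloc_box = {(\<tau>, E). \<forall>t. (\<tau> $ t, E $ t) \<in> slot_box}"

(* The SINR fractions are undefined where a denominator vanishes (for instance, that of the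
   last user when \<tau> $ t = 1), whereas division is total in HOL with y / 0 = 0.  On alloc_box with
   nonnegative gains the denominators are nonnegative, so there this is the set on which all
   fractions are genuinely defined. *)
definition sinr_domain ::
    "('k \<Rightarrow> 't \<Rightarrow> real) \<Rightarrow> real \<Rightarrow> ('k::{finite,linorder}, 't::finite) alloc set" where
  "sinr_domain g \<sigma> = {(\<tau>, E). \<forall>i t. 0 < interference_noise g \<sigma> t i (\<tau> $ t, E $ t)}"

definition affine_function :: "('v::real_vector \<Rightarrow> real) \<Rightarrow> bool" where
  "affine_function a \<longleftrightarrow> (\<exists>l c. linear l \<and> (\<forall>z. a z = l z + c))"

(* P is a constraint expressible, at the points of D, by one affine inequality; D matters only for
   the SINR thresholds, which become affine after multiplication by a positive denominator. *)
definition affine_constraint_on :: "'v::real_vector set \<Rightarrow> ('v \<Rightarrow> bool) \<Rightarrow> bool" where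
  "affine_constraint_on D P \<longleftrightarrow> (\<exists>a. affine_function a \<and> (\<forall>z\<in>D. P z \<longleftrightarrow> a z \<le> 0))"

definition convex_maximization_problem :: "'v::real_vector set \<Rightarrow> ('v \<Rightarrow> real) \<Rightarrow> bool" where
  "convex_maximization_problem F f \<longleftrightarrow> convex F \<and> concave_on F f"

end

theory Submission
  imports Defs
begin

text \<open>
  In slot \<open>t\<close> put \<open>u = 1 - s\<close>, \<open>c = \<sigma>\<^sup>2\<close> and \<open>a\<^sub>i = g i t * e $ i\<close>.  While \<open>u > 0\<close>, the factor
  \<open>1 + x\<^sub>i\<close> is the quotient of the total power received before user \<open>i\<close> is decoded by the total power
  left afterwards, so the product of these factors telescopes to \<open>1 + (\<Sum>i. a\<^sub>i) / (c * u)\<close>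
  (lemma \<open>sum_log_telescope\<close>).  For \<open>u = 0\<close> both sides of the sum-rate formula are \<open>0\<close>.

  The sum rate is therefore the perspective of a logarithm, composed with an affine map.  Its
  concavity is proved through supporting affine functions: \<open>ln y \<le> ln m + y / m - 1\<close>, multiplied by
  \<open>u\<close>, bounds \<open>u * ln (1 + A / (c * u))\<close> by a function that is linear in \<open>(u, A)\<close> and agrees with it
  at the points where \<open>1 + A / (c * u) = m\<close>.  This bound survives at \<open>u = 0\<close>, so the argument covers
  the closed box, including slots spent entirely on energy transfer
  (lemmas \<open>perspective_ln_le_tangent\<close> and \<open>perspective_ln_concave\<close>).

  After elimination of \<open>x\<close>, every constraint except the SINR threshold is visibly affine in
  \<open>(\<tau>, E)\<close>, and the threshold becomes affine on multiplication by the denominator.  For convexity of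
  the feasible set, vanishing denominators have to be considered as well: there the fraction has the
  value \<open>0\<close>.  If \<open>S i \<le> 0\<close>, the threshold then holds on the whole box; if \<open>S i > 0\<close>, it forces the
  denominator to be positive and cuts out an intersection of half-spaces
  (lemma \<open>convex_threshold_region\<close>).
\<close>

section \<open>Telescoping of the decoding chain\<close>

text \<open>
  The telescoping is an induction over the set of users, adding the earliest decoded one last; the
  interference is therefore restricted to \<open>A\<close> and becomes that of the problem for \<open>A = UNIV\<close>.
\<close>

lemma sum_log_telescope:
  fixes a :: "'k::linorder \<Rightarrow> real"
  assumes "finite A" and c: "0 < c" and a: "\<And>i. 0 \<le> a i"
  shows "(\<Sum>i\<in>A. log 2 (1 + a i / (c + (\<Sum>j\<in>A \<inter> {i<..}. a j)))) = log 2 (1 + (\<Sum>i\<in>A. a i) / c)"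
  using \<open>finite A\<close>
proof (induction A rule: finite_linorder_min_induct)
  case empty
  then show ?case by simp
next
  \<comment> \<open>Adding a user who is decoded before all others leaves the interference of the others alone.\<close>
  case (insert b A)
  let ?s = "\<Sum>i\<in>A. a i"
  have s: "0 \<le> ?s" by (simp add: a sum_nonneg)
  have later: "insert b A \<inter> {b<..} = A" using insert.hyps by auto
  have same: "insert b A \<inter> {i<..} = A \<inter> {i<..}" if "i \<in> A" for i
    using insert.hyps that by auto
  have b: "b \<notin> A" using insert.hyps by auto
  have "(\<Sum>i\<in>insert b A. log 2 (1 + a i / (c + (\<Sum>j\<in>insert b A \<inter> {i<..}. a j))))
      = log 2 (1 + a b / (c + ?s)) + log 2 (1 + ?s / c)"
    using insert.hyps(1) b insert.IH by (simp add: later same cong: sum.cong)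
  also have "\<dots> = log 2 ((1 + a b / (c + ?s)) * (1 + ?s / c))"
    using c s a[of b] by (intro log_mult_pos[symmetric] add_pos_nonneg) auto
  also have "(1 + a b / (c + ?s)) * (1 + ?s / c) = 1 + (\<Sum>i\<in>insert b A. a i) / c"
  proof -
    have cs: "c + ?s > 0" using c s by linarith
    then have "1 + a b / (c + ?s) = (c + ?s + a b) / (c + ?s)" by (simp add: field_simps)
    moreover have "1 + ?s / c = (c + ?s) / c" using c by (simp add: field_simps)
    ultimately have "(1 + a b / (c + ?s)) * (1 + ?s / c) = (c + ?s + a b) / c" using cs by simp
    then show ?thesis using c insert.hyps(1) b by (simp add: field_simps)
  qed
  finally show ?case .
qed

lemma sum_throughput_closed_form:
  fixes g :: "'k::{finite,linorder} \<Rightarrow> 't \<Rightarrow> real"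
  assumes noise: "0 < \<sigma>" and gain: "\<And>i t. 0 \<le> g i t" and box: "(s, e) \<in> slot_box"
  shows "sum_throughput g \<sigma> t (s, e) =
    (1 - s) * log 2 (1 + (\<Sum>i\<in>UNIV. g i t * e $ i) / (\<sigma>\<^sup>2 * (1 - s)))"
proof (cases "s = 1")
  case True
  then show ?thesis by (simp add: sum_throughput_def throughput_def)
next
  case False
  then have c: "0 < \<sigma>\<^sup>2 * (1 - s)" using noise box by (simp add: slot_box_def)
  have "0 \<le> g i t * e $ i" for i using gain box by (simp add: slot_box_def)
  from sum_log_telescope[where A = UNIV and a = "\<lambda>i. g i t * e $ i", OF finite c this] show ?thesis
    by (simp add: sum_throughput_def throughput_def sinr_def interference_noise_def
        sum_distrib_left[symmetric])
qed

section \<open>Concavity of the sum rate\<close>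

text \<open>
  This is the tangent inequality \<open>ln y \<le> ln m + y / m - 1\<close> at \<open>y = 1 + A / (c * u)\<close>, times \<open>u\<close>.
  The right-hand side is linear in \<open>(u, A)\<close>; at \<open>u = 0\<close> the inequality reduces to \<open>0 \<le> A / (c * m)\<close>.
\<close>

lemma perspective_ln_le_tangent:
  fixes u A c m :: real
  assumes "0 \<le> u" "0 \<le> A" "0 < c" "0 < m"
  shows "u * ln (1 + A / (c * u)) \<le> u * (ln m - 1 + 1 / m) + A / (c * m)"
proof (cases "u = 0")
  case True
  then show ?thesis using assms by simp
next
  case False
  define y where "y = 1 + A / (c * u)"
  have u: "0 < u" using False assms by simp
  have y: "0 < y" unfolding y_def using assms u by (intro add_pos_nonneg) auto
  have "ln (y / m) \<le> y / m - 1" using y assms by (intro ln_le_minus_one) simp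
  then have "ln y \<le> ln m - 1 + y / m" using y assms by (simp add: ln_div)
  then have "u * ln y \<le> u * (ln m - 1 + y / m)" using u by (intro mult_left_mono) auto
  also have "\<dots> = u * (ln m - 1 + 1 / m) + A / (c * m)"
    using u assms by (simp add: y_def field_simps)
  finally show ?thesis by (simp add: y_def)
qed

lemma perspective_ln_concave:
  fixes u v A B c p q :: real
  assumes "0 \<le> u" "0 \<le> v" "0 \<le> A" "0 \<le> B" "0 < c" "0 \<le> p" "0 \<le> q"
  shows "p * (u * ln (1 + A / (c * u))) + q * (v * ln (1 + B / (c * v)))
    \<le> (p * u + q * v) * ln (1 + (p * A + q * B) / (c * (p * u + q * v)))"
proof (cases "p * u + q * v = 0")
  case True
  then have "p * u = 0" "q * v = 0"
    using assms by (auto simp: add_nonneg_eq_0_iff)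
  then show ?thesis by auto
next
  case False
  define w where "w = p * u + q * v"
  define C where "C = p * A + q * B"
  \<comment> \<open>Both summands are compared with the tangent at the combined point, where it is exact.\<close>
  define m where "m = 1 + C / (c * w)"
  have w: "0 < w" using False assms by (simp add: w_def order_less_le)
  have C: "0 \<le> C" using assms by (simp add: C_def)
  have m: "0 < m" unfolding m_def using w C assms by (intro add_pos_nonneg) auto
  have wm: "w * m = w + C / c" using w assms by (simp add: m_def field_simps)
  have "p * (u * ln (1 + A / (c * u))) + q * (v * ln (1 + B / (c * v)))
      \<le> p * (u * (ln m - 1 + 1 / m) + A / (c * m)) + q * (v * (ln m - 1 + 1 / m) + B / (c * m))"
    using assms m by (intro add_mono mult_left_mono perspective_ln_le_tangent) auto
  also have "\<dots> = w * (ln m - 1) + (w + C / c) / m"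
    using m assms by (simp add: w_def C_def field_simps)
  also have "\<dots> = w * ln m" using m by (simp add: wm[symmetric] algebra_simps)
  finally show ?thesis by (simp add: w_def C_def m_def)
qed

lemma convex_slot_box: "convex slot_box"
  by (force simp: convex_def slot_box_def intro!: convex_bound_le)

lemma concave_sum_throughput:
  fixes g :: "'k::{finite,linorder} \<Rightarrow> 't \<Rightarrow> real"
  assumes noise: "0 < \<sigma>" and gain: "\<And>i t. 0 \<le> g i t"
  shows "concave_on slot_box (sum_throughput g \<sigma> t)"
  unfolding concave_on_iff
proof (intro conjI convex_slot_box ballI allI impI)
  fix x y :: "real \<times> (real, 'k) vec" and p q :: real
  assume x: "x \<in> slot_box" and y: "y \<in> slot_box" and pq: "0 \<le> p" "0 \<le> q" "p + q = 1"
  define A where "A z = (\<Sum>i\<in>UNIV. g i t * snd z $ i)" for z :: "real \<times> (real, 'k) vec"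
  have A: "0 \<le> A z" if "z \<in> slot_box" for z
    using that gain by (auto simp: A_def slot_box_def intro!: sum_nonneg)
  have form: "sum_throughput g \<sigma> t z = (1 - fst z) * ln (1 + A z / (\<sigma>\<^sup>2 * (1 - fst z))) / ln 2"
    if "z \<in> slot_box" for z
    using sum_throughput_closed_form[where g = g and t = t and s = "fst z" and e = "snd z", OF noise gain] that
    by (simp add: A_def log_def)
  have Az: "A (p *\<^sub>R x + q *\<^sub>R y) = p * A x + q * A y"
    by (simp add: A_def sum.distrib sum_distrib_left algebra_simps)
  have uz: "1 - fst (p *\<^sub>R x + q *\<^sub>R y) = p * (1 - fst x) + q * (1 - fst y)"
    using pq by (simp add: algebra_simps)
  have z: "p *\<^sub>R x + q *\<^sub>R y \<in> slot_box"
    using convexD[OF convex_slot_box x y] pq by simp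
  have bounds: "0 \<le> 1 - fst x" "0 \<le> 1 - fst y" using x y by (auto simp: slot_box_def)
  have "p * ((1 - fst x) * ln (1 + A x / (\<sigma>\<^sup>2 * (1 - fst x))))
      + q * ((1 - fst y) * ln (1 + A y / (\<sigma>\<^sup>2 * (1 - fst y))))
      \<le> (1 - fst (p *\<^sub>R x + q *\<^sub>R y))
        * ln (1 + A (p *\<^sub>R x + q *\<^sub>R y) / (\<sigma>\<^sup>2 * (1 - fst (p *\<^sub>R x + q *\<^sub>R y))))"
    unfolding Az uz
    using perspective_ln_concave[OF bounds A[OF x] A[OF y] _ pq(1,2), of "\<sigma>\<^sup>2"] noise by simp
  then have "(p * ((1 - fst x) * ln (1 + A x / (\<sigma>\<^sup>2 * (1 - fst x))))
      + q * ((1 - fst y) * ln (1 + A y / (\<sigma>\<^sup>2 * (1 - fst y))))) / ln 2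
      \<le> (1 - fst (p *\<^sub>R x + q *\<^sub>R y))
        * ln (1 + A (p *\<^sub>R x + q *\<^sub>R y) / (\<sigma>\<^sup>2 * (1 - fst (p *\<^sub>R x + q *\<^sub>R y)))) / ln 2"
    by (rule divide_right_mono) simp
  then show "p * sum_throughput g \<sigma> t x + q * sum_throughput g \<sigma> t y
      \<le> sum_throughput g \<sigma> t (p *\<^sub>R x + q *\<^sub>R y)"
    unfolding form[OF x] form[OF y] form[OF z] by (simp only: add_divide_distrib times_divide_eq_right)
qed

lemma P1_objective_with_sinr:
  "P1_objective (with_sinr g \<sigma> z) = (\<Sum>t\<in>UNIV. sum_throughput g \<sigma> t (fst z $ t, snd z $ t))"
  by (simp add: P1_objective_def with_sinr_def sum_throughput_def split_beta)

lemma convex_alloc_box: "convex (alloc_box :: ('k::finite, 't::finite) alloc set)"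
proof (rule convexI)
  fix x y :: "('k, 't) alloc" and p q :: real
  assume xy: "x \<in> alloc_box" "y \<in> alloc_box" and pq: "0 \<le> p" "0 \<le> q" "p + q = 1"
  have "p *\<^sub>R (fst x $ t, snd x $ t) + q *\<^sub>R (fst y $ t, snd y $ t) \<in> slot_box" for t
    using xy pq by (intro convexD[OF convex_slot_box]) (auto simp: alloc_box_def)
  then show "p *\<^sub>R x + q *\<^sub>R y \<in> alloc_box"
    by (auto simp: alloc_box_def split_beta)
qed

lemma concave_objective:
  fixes g :: "'k::{finite,linorder} \<Rightarrow> 't::finite \<Rightarrow> real"
  assumes noise: "0 < \<sigma>" and gain: "\<And>i t. 0 \<le> g i t"
  shows "concave_on alloc_box (\<lambda>z. P1_objective (with_sinr g \<sigma> z))"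
  unfolding concave_on_iff
proof (intro conjI convex_alloc_box ballI allI impI)
  fix x y :: "('k, 't) alloc" and p q :: real
  assume xy: "x \<in> alloc_box" "y \<in> alloc_box" and pq: "0 \<le> p" "0 \<le> q" "p + q = 1"
  have slots: "(fst x $ t, snd x $ t) \<in> slot_box" "(fst y $ t, snd y $ t) \<in> slot_box" for t
    using xy by (auto simp: alloc_box_def)
  have "p * sum_throughput g \<sigma> t (fst x $ t, snd x $ t) + q * sum_throughput g \<sigma> t (fst y $ t, snd y $ t)
      \<le> sum_throughput g \<sigma> t (p *\<^sub>R (fst x $ t, snd x $ t) + q *\<^sub>R (fst y $ t, snd y $ t))" for t
    using concave_sum_throughput[where g = g and t = t, OF noise gain] slots pq
    unfolding concave_on_iff by blast
  then show "p * P1_objective (with_sinr g \<sigma> x) + q * P1_objective (with_sinr g \<sigma> y)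
      \<le> P1_objective (with_sinr g \<sigma> (p *\<^sub>R x + q *\<^sub>R y))"
    by (simp add: P1_objective_with_sinr sum_distrib_left sum.distrib[symmetric] sum_mono)
qed

section \<open>Affine constraints\<close>

lemma affine_function_const: "affine_function (\<lambda>z. c)"
  unfolding affine_function_def by (intro exI[of _ "\<lambda>z. 0"] exI[of _ c]) (simp add: linear_iff)

lemma affine_function_linear: "linear a \<Longrightarrow> affine_function a"
  unfolding affine_function_def by (intro exI[of _ a] exI[of _ 0]) simp

lemma affine_function_add:
  assumes "affine_function a" "affine_function b"
  shows "affine_function (\<lambda>z. a z + b z)"
proof -
  obtain l c l' c' where "linear l" "\<And>z. a z = l z + c" "linear l'" "\<And>z. b z = l' z + c'"
    using assms unfolding affine_function_def by metis
  then show ?thesis unfolding affine_function_def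
    by (intro exI[of _ "\<lambda>z. l z + l' z"] exI[of _ "c + c'"]) (simp add: linear_compose_add)
qed

lemma affine_function_cmult:
  assumes "affine_function a"
  shows "affine_function (\<lambda>z. r * a z)"
proof -
  obtain l c where "linear l" "\<And>z. a z = l z + c"
    using assms unfolding affine_function_def by metis
  then show ?thesis unfolding affine_function_def
    using linear_compose_scale_right[of l r]
    by (intro exI[of _ "\<lambda>z. r * l z"] exI[of _ "r * c"]) (simp add: algebra_simps)
qed

lemma affine_function_diff:
  assumes "affine_function a" "affine_function b"
  shows "affine_function (\<lambda>z. a z - b z)"
  using affine_function_add[OF assms(1) affine_function_cmult[OF assms(2), of "-1"]] by simp

lemma affine_function_sum:
  assumes "\<And>j. j \<in> A \<Longrightarrow> affine_function (a j)"
  shows "affine_function (\<lambda>z. \<Sum>j\<in>A. a j z)"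
  using assms
  by (induction A rule: infinite_finite_induct) (auto intro: affine_function_const affine_function_add)

lemma affine_function_duration: "affine_function (\<lambda>z :: ('k::finite, 't::finite) alloc. fst z $ t)"
  by (intro affine_function_linear) (simp add: linear_iff)

lemma affine_function_energy: "affine_function (\<lambda>z :: ('k::finite, 't::finite) alloc. snd z $ t $ i)"
  by (intro affine_function_linear) (simp add: linear_iff)

lemmas affine_function_intros = affine_function_const affine_function_add affine_function_diff
  affine_function_cmult affine_function_sum affine_function_duration affine_function_energy

lemma affine_function_interference:
  "affine_function (\<lambda>z :: ('k::{finite,linorder}, 't::finite) alloc.
     interference_noise g \<sigma> t i (fst z $ t, snd z $ t))"
  unfolding interference_noise_def prod.case by (intro affine_function_intros)

lemma affine_function_combination:
  assumes "affine_function a" "p + q = 1"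
  shows "a (p *\<^sub>R x + q *\<^sub>R y) = p * a x + q * a y"
proof -
  obtain l c where l: "linear l" "\<And>z. a z = l z + c"
    using assms unfolding affine_function_def by metis
  have "c = (p + q) * c" using assms by simp
  then show ?thesis using l by (simp add: linear_add linear_scale algebra_simps)
qed

lemma convex_affine_le: "affine_function a \<Longrightarrow> convex {z. a z \<le> 0}"
  by (rule convexI)
    (simp add: affine_function_combination add_nonpos_nonpos mult_nonneg_nonpos)

lemma pos_convex_combination:
  fixes a b p q :: real
  assumes "0 < a" "0 < b" "0 \<le> p" "0 \<le> q" "p + q = 1"
  shows "0 < p * a + q * b"
  using convex_bound_lt[of "-a" 0 "-b" p q] assms by simp

lemma convex_affine_pos: "affine_function a \<Longrightarrow> convex {z. 0 < a z}"
  by (rule convexI) (simp add: affine_function_combination pos_convex_combination)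

lemma convex_affine_constraint: "affine_constraint_on UNIV P \<Longrightarrow> convex (Collect P)"
  unfolding affine_constraint_on_def using convex_affine_le by (metis UNIV_I Collect_cong)

lemma affine_energy_causality:
  "affine_constraint_on UNIV (\<lambda>z. energy_causality \<gamma> i t (with_sinr g \<sigma> z))"
  unfolding affine_constraint_on_def
  by (rule exI[of _ "\<lambda>z. (\<Sum>n\<in>{..t}. snd z $ n $ i) - (\<Sum>n\<in>{..t}. \<gamma> i n * fst z $ n)"])
    (auto simp: energy_causality_def with_sinr_def intro!: affine_function_intros)

lemma affine_duration_lower:
  "affine_constraint_on UNIV (\<lambda>z. duration_lower t (with_sinr g \<sigma> z))"
  unfolding affine_constraint_on_def
  by (rule exI[of _ "\<lambda>z. 0 - fst z $ t"])
    (simp add: duration_lower_def with_sinr_def split_beta affine_function_intros del: diff_0)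

lemma affine_duration_upper:
  "affine_constraint_on UNIV (\<lambda>z. duration_upper t (with_sinr g \<sigma> z))"
  unfolding affine_constraint_on_def
  by (rule exI[of _ "\<lambda>z. fst z $ t - 1"])
    (simp add: duration_upper_def with_sinr_def split_beta affine_function_intros)

lemma affine_energy_nonneg:
  "affine_constraint_on UNIV (\<lambda>z. energy_nonneg i t (with_sinr g \<sigma> z))"
  unfolding affine_constraint_on_def
  by (rule exI[of _ "\<lambda>z. 0 - snd z $ t $ i"])
    (simp add: energy_nonneg_def with_sinr_def split_beta affine_function_intros del: diff_0)

text \<open>The SINR threshold after multiplication by the denominator.\<close>

definition threshold_excess ::
  "('k \<Rightarrow> 't \<Rightarrow> real) \<Rightarrow> real \<Rightarrow> ('k \<Rightarrow> real) \<Rightarrow> 'k \<Rightarrow> 't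
    \<Rightarrow> ('k::{finite,linorder}, 't::finite) alloc \<Rightarrow> real" where
  "threshold_excess g \<sigma> S i t z =
     S i * interference_noise g \<sigma> t i (fst z $ t, snd z $ t) - g i t * snd z $ t $ i"

lemma affine_function_threshold_excess: "affine_function (threshold_excess g \<sigma> S i t)"
  unfolding threshold_excess_def [abs_def]
  by (intro affine_function_intros affine_function_interference)

lemma decoding_threshold_iff_excess:
  assumes "0 < interference_noise g \<sigma> t i (fst z $ t, snd z $ t)"
  shows "decoding_threshold S i t (with_sinr g \<sigma> z) \<longleftrightarrow> threshold_excess g \<sigma> S i t z \<le> 0"
  using assms
  by (simp add: decoding_threshold_def with_sinr_def split_beta sinr_def threshold_excess_def
      pos_le_divide_eq)

lemma affine_decoding_threshold:
  "affine_constraint_on (sinr_domain g \<sigma>) (\<lambda>z. decoding_threshold S i t (with_sinr g \<sigma> z))"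
  unfolding affine_constraint_on_def
proof (intro exI[of _ "threshold_excess g \<sigma> S i t"] conjI ballI affine_function_threshold_excess)
  fix z assume "z \<in> sinr_domain g \<sigma>"
  then show "decoding_threshold S i t (with_sinr g \<sigma> z) \<longleftrightarrow> threshold_excess g \<sigma> S i t z \<le> 0"
    by (intro decoding_threshold_iff_excess) (auto simp: sinr_domain_def)
qed

section \<open>Convexity of the feasible region\<close>

lemma convex_sinr_domain: "convex (sinr_domain g \<sigma>)"
proof -
  have "sinr_domain g \<sigma> = (\<Inter>i. \<Inter>t. {z. 0 < interference_noise g \<sigma> t i (fst z $ t, snd z $ t)})"
    by (auto simp: sinr_domain_def)
  then show ?thesis
    by (simp add: convex_INT convex_affine_pos affine_function_interference)
qed

lemma interference_noise_nonneg:
  assumes gain: "\<And>i t. 0 \<le> g i t" and box: "z \<in> alloc_box"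
  shows "0 \<le> interference_noise g \<sigma> t i (fst z $ t, snd z $ t)"
  using assms by (auto simp: interference_noise_def alloc_box_def slot_box_def split_beta
      intro!: add_nonneg_nonneg sum_nonneg)

text \<open>
  Where the denominator vanishes, the threshold reads \<open>S i \<le> 0\<close>.  Its truth there thus depends on
  the sign of \<open>S i\<close> only, and for each sign it fits the convex region where the denominator is
  positive: a nonpositive threshold excludes nothing, and a positive one excludes the zero set
  altogether.
\<close>

lemma convex_threshold_region:
  fixes g :: "'k::{finite,linorder} \<Rightarrow> 't::finite \<Rightarrow> real"
  assumes gain: "\<And>i t. 0 \<le> g i t"
  shows "convex {z \<in> alloc_box. decoding_threshold S i t (with_sinr g \<sigma> z)}"
proof -
  let ?D = "\<lambda>z. interference_noise g \<sigma> t i (fst z $ t, snd z $ t)"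
  have sinr: "decoding_threshold S i t (with_sinr g \<sigma> z) \<longleftrightarrow> S i \<le> g i t * snd z $ t $ i / ?D z"
    for z :: "('k, 't) alloc"
    by (simp add: decoding_threshold_def with_sinr_def sinr_def split_beta)
  show ?thesis
  proof (cases "S i \<le> 0")
    case True
    have "decoding_threshold S i t (with_sinr g \<sigma> z)" if z: "z \<in> alloc_box" for z
    proof -
      have "0 \<le> g i t * snd z $ t $ i" using z gain by (auto simp: alloc_box_def slot_box_def split_beta)
      then have "0 \<le> g i t * snd z $ t $ i / ?D z"
        using interference_noise_nonneg[where g = g, OF gain z] by (intro divide_nonneg_nonneg) auto
      with True show ?thesis by (simp add: sinr)
    qed
    then have "{z \<in> alloc_box. decoding_threshold S i t (with_sinr g \<sigma> z)} = alloc_box" by auto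
    then show ?thesis by (simp add: convex_alloc_box)
  next
    case False
    have "0 < ?D z" if "z \<in> alloc_box" "decoding_threshold S i t (with_sinr g \<sigma> z)" for z
      using that False interference_noise_nonneg[where g = g and t = t and i = i and \<sigma> = \<sigma>, OF gain that(1)]
      by (cases "?D z = 0") (auto simp: sinr)
    then have "{z \<in> alloc_box. decoding_threshold S i t (with_sinr g \<sigma> z)}
        = alloc_box \<inter> {z. 0 < ?D z} \<inter> {z. threshold_excess g \<sigma> S i t z \<le> 0}"
      using decoding_threshold_iff_excess by blast
    then show ?thesis
      by (simp add: convex_Int convex_alloc_box convex_affine_pos convex_affine_le
          affine_function_interference affine_function_threshold_excess)
  qed
qed

lemma P1_feasible_eq_with_sinr:
  "p \<in> P1_feasible g \<sigma> \<gamma> S \<Longrightarrow> p = with_sinr g \<sigma> (fst p, fst (snd p))"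
  by (auto simp: P1_feasible_def with_sinr_def sinr_equation_def split_beta vec_eq_iff prod_eq_iff)

lemma P1_allocations_eq:
  "P1_allocations g \<sigma> \<gamma> S = {z. with_sinr g \<sigma> z \<in> P1_feasible g \<sigma> \<gamma> S}"
proof (intro set_eqI iffI)
  fix z assume "z \<in> P1_allocations g \<sigma> \<gamma> S"
  then obtain x where "(fst z, snd z, x) \<in> P1_feasible g \<sigma> \<gamma> S"
    by (auto simp: P1_allocations_def)
  with P1_feasible_eq_with_sinr[OF this] show "z \<in> {z. with_sinr g \<sigma> z \<in> P1_feasible g \<sigma> \<gamma> S}"
    by simp
qed (auto simp: P1_allocations_def with_sinr_def)

lemma P1_allocations_decompose:
  "P1_allocations g \<sigma> \<gamma> S = (\<Inter>i. \<Inter>t.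
     {z. energy_causality \<gamma> i t (with_sinr g \<sigma> z)}
     \<inter> {z \<in> alloc_box. decoding_threshold S i t (with_sinr g \<sigma> z)})"
  by (auto simp: P1_allocations_eq P1_feasible_def sinr_equation_def duration_lower_def
      duration_upper_def energy_nonneg_def alloc_box_def slot_box_def with_sinr_def)

lemma P1_allocations_subset_box: "P1_allocations g \<sigma> \<gamma> S \<subseteq> alloc_box"
  by (auto simp: P1_allocations_decompose)

lemma convex_P1_allocations:
  assumes gain: "\<And>i t. 0 \<le> g i t"
  shows "convex (P1_allocations g \<sigma> \<gamma> S)"
  unfolding P1_allocations_decompose
  by (intro convex_INT convex_Int convex_threshold_region gain
      convex_affine_constraint affine_energy_causality)

section \<open>The convex optimization problem\<close>

theorem mainTheorem1:
  fixes g h \<gamma> :: "'k::{finite,linorder} \<Rightarrow> 't::{finite,linorder} \<Rightarrow> real"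
    and \<eta> S :: "'k \<Rightarrow> real"
    and P\<^sub>B \<sigma> :: real
  assumes noise_pos: "0 < \<sigma>"
    and gain_nonneg: "\<And>i t. 0 \<le> g i t"
    and harvest_rate: "\<And>i t. \<gamma> i t = \<eta> i * h i t * P\<^sub>B"
  shows
    "(\<forall>t. \<forall>(s, e)\<in>slot_box.
        sum_throughput g \<sigma> t (s, e) =
          (1 - s) * log 2 (1 + (\<Sum>i\<in>UNIV. g i t * e $ i) / (\<sigma>\<^sup>2 * (1 - s)))) \<and>
     (\<forall>t. concave_on slot_box (sum_throughput g \<sigma> t)) \<and>
     (\<forall>\<tau> E. P1_objective (with_sinr g \<sigma> (\<tau>, E)) =
        (\<Sum>t\<in>UNIV. sum_throughput g \<sigma> t (\<tau> $ t, E $ t))) \<and>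
     concave_on alloc_box (\<lambda>z. P1_objective (with_sinr g \<sigma> z)) \<and>
     (\<forall>i t.
        affine_constraint_on UNIV (\<lambda>z. energy_causality \<gamma> i t (with_sinr g \<sigma> z)) \<and>
        affine_constraint_on (sinr_domain g \<sigma>) (\<lambda>z. decoding_threshold S i t (with_sinr g \<sigma> z)) \<and>
        affine_constraint_on UNIV (\<lambda>z. duration_lower t (with_sinr g \<sigma> z)) \<and>
        affine_constraint_on UNIV (\<lambda>z. duration_upper t (with_sinr g \<sigma> z)) \<and>
        affine_constraint_on UNIV (\<lambda>z. energy_nonneg i t (with_sinr g \<sigma> z))) \<and>
     (\<forall>p\<in>P1_feasible g \<sigma> \<gamma> S. p = with_sinr g \<sigma> (fst p, fst (snd p))) \<and>
     convex_maximization_problem (P1_allocations g \<sigma> \<gamma> S)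
       (\<lambda>z. P1_objective (with_sinr g \<sigma> z)) \<and>
     convex_maximization_problem (P1_allocations g \<sigma> \<gamma> S \<inter> sinr_domain g \<sigma>)
       (\<lambda>z. P1_objective (with_sinr g \<sigma> z))"
proof (intro conjI allI ballI)
  fix t and z :: "real \<times> (real, 'k) vec"
  assume "z \<in> slot_box"
  then show "case z of (s, e) \<Rightarrow> sum_throughput g \<sigma> t (s, e) =
      (1 - s) * log 2 (1 + (\<Sum>i\<in>UNIV. g i t * e $ i) / (\<sigma>\<^sup>2 * (1 - s)))"
    using sum_throughput_closed_form[OF noise_pos gain_nonneg] by auto
next
  show "concave_on slot_box (sum_throughput g \<sigma> t)" for t
    by (rule concave_sum_throughput[OF noise_pos gain_nonneg])
next
  show "P1_objective (with_sinr g \<sigma> (\<tau>, E)) = (\<Sum>t\<in>UNIV. sum_throughput g \<sigma> t (\<tau> $ t, E $ t))"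
    for \<tau> and E :: "((real, 'k) vec, 't) vec"
    by (simp add: P1_objective_with_sinr)
next
  show "concave_on alloc_box (\<lambda>z. P1_objective (with_sinr g \<sigma> z))"
    by (rule concave_objective[OF noise_pos gain_nonneg])
next
  fix p assume "p \<in> P1_feasible g \<sigma> \<gamma> S"
  then show "p = with_sinr g \<sigma> (fst p, fst (snd p))" by (rule P1_feasible_eq_with_sinr)
next
  have problem: "convex_maximization_problem F (\<lambda>z. P1_objective (with_sinr g \<sigma> z))"
    if "convex F" "F \<subseteq> alloc_box" for F
    using that concave_objective[where g = g, OF noise_pos gain_nonneg]
    unfolding convex_maximization_problem_def concave_on_def by (blast intro: convex_on_subset)
  have convex: "convex (P1_allocations g \<sigma> \<gamma> S)"
    by (rule convex_P1_allocations[OF gain_nonneg])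
  show "convex_maximization_problem (P1_allocations g \<sigma> \<gamma> S) (\<lambda>z. P1_objective (with_sinr g \<sigma> z))"
    by (intro problem convex P1_allocations_subset_box)
  show "convex_maximization_problem (P1_allocations g \<sigma> \<gamma> S \<inter> sinr_domain g \<sigma>)
      (\<lambda>z. P1_objective (with_sinr g \<sigma> z))"
    by (intro problem convex_Int convex convex_sinr_domain le_infI1 P1_allocations_subset_box)
qed (rule affine_energy_causality affine_decoding_threshold affine_duration_lower
    affine_duration_upper affine_energy_nonneg)+

end
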